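(* For $\mu\in\mathbb{R}$ and $0\le d<2\mu$, it holds that for any $t<\mu-d/2$, $$\sup_{\mathbb{P}\in\mathcal{P}(\mu,d)}\mathbb{E}(X\mid X\ge t)=\mu+\frac{(\mu-t)d}{2(\mu-t)-d}.$$
   Context: $\mathcal{P}(\mu,d)$ is the set of all probability distributions $\mathbb{P}$ on $\mathbb{R}$ such that, for $X\sim\mathbb{P}$, $\mathbb{E}_{\mathbb{P}}(X)=\mu$ and $\mathbb{E}_{\mathbb{P}}(|X-\mu|)=d$. *)

theory Defs
  imports "HOL-Probability.Probability"
begin

definition mean_mad_distributions :: "real \<Rightarrow> real \<Rightarrow> real measure set" where
  "mean_mad_distributions \<mu> d =
     {P. real_distribution P \<and> integrable P (\<lambda>x. x) \<and>
         (LINT x|P. x) = \<mu> \<and> (LINT x|P. \<bar>x - \<mu>\<bar>) = d}"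

text \<open>The expectation of \<open>f\<close> given the event \<open>A\<close>, that is, its expectation under the conditional
  law \<open>B \<mapsto> P (A \<inter> B) / P A\<close>. It is meaningful only if \<open>P A > 0\<close>. This always holds for
  \<open>A = {t..}\<close> with \<open>t\<close> below the mean of \<open>P\<close>.\<close>

definition cond_expectation_event :: "'a measure \<Rightarrow> ('a \<Rightarrow> real) \<Rightarrow> 'a set \<Rightarrow> real" where
  "cond_expectation_event P f A = (LINT x|uniform_measure P A. f x)"

end

theory Submission
  imports Defs
begin

text \<open>Put \<open>s = \<mu> - t\<close>, so that \<open>s > d / 2\<close>. The deviations of \<open>X\<close> below its mean and those above it
  each contribute \<open>d / 2\<close> to the mean absolute deviation. Let \<open>p\<close> be the probability of \<open>X < t\<close> and
  \<open>m\<close> the expectation of \<open>\<mu> - X\<close> restricted to that event. Since \<open>X\<close> has mean \<open>\<mu>\<close>, the excess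
  \<open>X - \<mu>\<close> restricted to \<open>X \<ge> t\<close> also has expectation \<open>m\<close>, and hence the conditional expectation is
  \<open>\<mu> + m / (1 - p)\<close>. Every point below \<open>t\<close> lies at distance at least \<open>s\<close> from \<open>\<mu>\<close>, so that
  \<open>s p \<le> m \<le> d / 2\<close>. The conditional expectation is therefore largest when the discarded mass
  carries the whole lower deviation \<open>d / 2\<close> (which makes \<open>m\<close> large) and sits as close to \<open>t\<close> as
  possible (which makes \<open>p\<close> as large as \<open>d / (2 s)\<close>); this yields the upper bound in
  \<open>cond_expectation_le\<close>.

  The supremum need not be attained, as mass at \<open>t\<close> itself is not discarded. It is approached by
  two-point laws with the lower atom at \<open>\<mu> - u\<close> for \<open>u > s\<close>: the conditional expectation is then the
  upper atom \<open>\<mu> + u d / (2 u - d)\<close> (\<open>two_point_law_attains\<close>), and \<open>u\<close> tends to \<open>s\<close> from the right.\<close>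

lemma cond_expectation_event_eq:
  fixes f :: "'a \<Rightarrow> real"
  assumes "finite_measure P" "A \<in> sets P" "f \<in> borel_measurable P" "measure P A > 0"
  shows "cond_expectation_event P f A = (LINT x|P. indicator A x * f x) / measure P A"
proof -
  interpret finite_measure P by fact
  have "uniform_measure P A = density P (\<lambda>x. ennreal (indicator A x / measure P A))"
    unfolding uniform_measure_def
    using assms(4) by (intro arg_cong[where f = "density P"] ext)
      (auto simp: emeasure_eq_measure divide_ennreal simp flip: ennreal_indicator ennreal_1)
  then show ?thesis
    using assms by (simp add: cond_expectation_event_def integral_real_density)
qed

text \<open>Everything reduces to the two numbers \<open>a = 1 - p\<close> and \<open>m\<close>: the bound on \<open>m / a\<close> needs only
  \<open>s (1 - a) \<le> m \<le> d / 2\<close>, and these inequalities also force \<open>a > 0\<close> because \<open>s > d / 2\<close>.\<close>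

lemma cond_expectation_le:
  fixes \<mu> d t :: real
  assumes P: "P \<in> mean_mad_distributions \<mu> d" and "0 \<le> d" and t: "t < \<mu> - d / 2"
  shows "cond_expectation_event P (\<lambda>x. x) {t..}
           \<le> \<mu> + (\<mu> - t) * d / (2 * (\<mu> - t) - d)"
proof -
  interpret real_distribution P
    using P by (simp add: mean_mad_distributions_def)
  have int: "integrable P (\<lambda>x. x)" and mean: "(LINT x|P. x) = \<mu>"
    and mad: "(LINT x|P. \<bar>x - \<mu>\<bar>) = d"
    using P by (auto simp: mean_mad_distributions_def)
  define s where "s = \<mu> - t"
  define a where "a = measure P {t..}"
  define m where "m = (LINT x|P. indicator {..<t} x * (\<mu> - x))"
  have s: "2 * s - d > 0" "s > 0"
    using t \<open>0 \<le> d\<close> by (auto simp: s_def)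
  have int_ind: "integrable P (\<lambda>x. indicator B x * f x)"
    if "B \<in> sets borel" "integrable P f" for B and f :: "real \<Rightarrow> real"
    using integrable_mult_indicator[of B P f] that by simp
  have int_indicator: "integrable P (\<lambda>x. c * indicator B x)" if "B \<in> sets borel" for B and c :: real
    using int_ind[OF that, of "\<lambda>_. c"] by (simp add: mult.commute)
  have int_dev: "integrable P (\<lambda>x. \<mu> - x)"
    using int by simp
  have p: "measure P {..<t} = 1 - a"
  proof -
    have "{..<t} = UNIV - {t..}" by auto
    then show ?thesis
      using prob_compl[of "{t..}"] by (simp add: a_def)
  qed
  have "s * (1 - a) = (LINT x|P. s * indicator {..<t} x)"
    by (simp add: p)
  also have "\<dots> \<le> m"
    unfolding m_def using s
    by (intro integral_mono int_indicator int_ind int_dev)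
      (auto simp: s_def split: split_indicator)
  finally have lower: "s * (1 - a) \<le> m" .
  \<comment> \<open>The integrand on the right is the negative part of \<open>x - \<mu>\<close>.\<close>
  have "m \<le> (LINT x|P. (\<bar>x - \<mu>\<bar> + (\<mu> - x)) / 2)"
    unfolding m_def using s int
    by (intro integral_mono int_ind int_dev) (auto simp: s_def split: split_indicator)
  also have "\<dots> = d / 2"
    using int mean mad prob_space by simp
  finally have upper: "m \<le> d / 2" .
  have "2 * (s * a) \<ge> 2 * s - d"
    using lower upper by (simp add: algebra_simps)
  then have "s * a > 0"
    using s by linarith
  then have a: "a > 0"
    using s by (simp add: zero_less_mult_iff)
  have "(LINT x|P. indicator {t..} x * x)
      = (LINT x|P. \<mu> * indicator {t..} x - (\<mu> - x) + indicator {..<t} x * (\<mu> - x))"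
    by (intro Bochner_Integration.integral_cong)
      (auto split: split_indicator)
  also have "\<dots> = \<mu> * a + m"
    using int_ind[OF _ int_dev, of "{..<t}"] int_indicator[of "{t..}" \<mu>] int mean prob_space
    by (simp add: a_def m_def)
  finally have "cond_expectation_event P (\<lambda>x. x) {t..} = \<mu> + m / a"
    using a by (subst cond_expectation_event_eq)
      (auto simp: a_def field_simps intro: finite_measure_axioms)
  also have "m / a \<le> s * d / (2 * s - d)"
  proof -
    have "d * (s * (1 - a)) \<le> d * m"
      using lower \<open>0 \<le> d\<close> by (rule mult_left_mono)
    moreover have "2 * s * m \<le> 2 * s * (d / 2)"
      using upper s by (intro mult_left_mono) auto
    ultimately have "m * (2 * s - d) \<le> s * d * a"
      by (simp add: algebra_simps)
    then show ?thesis
      using a s by (simp add: field_simps)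
  qed
  finally show ?thesis
    by (simp add: s_def)
qed

text \<open>Once \<open>\<mu> - u\<close> is the lower atom, mean and mean absolute deviation determine both its weight and
  the upper atom. The event \<open>X \<ge> t\<close> retains the upper atom only.\<close>

lemma two_point_law_attains:
  fixes \<mu> d t u :: real
  assumes "0 \<le> d" "t < \<mu> - d / 2" "\<mu> - t < u"
  obtains P where "P \<in> mean_mad_distributions \<mu> d"
    and "cond_expectation_event P (\<lambda>x. x) {t..} = \<mu> + u * d / (2 * u - d)"
proof
  \<comment> \<open>Each atom must carry deviation \<open>d / 2\<close>: \<open>p u = d / 2\<close> and \<open>(1 - p) (r - \<mu>) = d / 2\<close>.\<close>
  define p where "p = d / (2 * u)"
  define r where "r = \<mu> + u * d / (2 * u - d)"
  define g where "g = (\<lambda>b. if b then \<mu> - u else r)"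
  define P where "P = distr (measure_pmf (bernoulli_pmf p)) borel g"
  have u: "u > 0" "2 * u - d > 0"
    using assms by auto
  have p: "0 \<le> p" "p < 1"
    using u \<open>0 \<le> d\<close> by (auto simp: p_def field_simps)
  have r: "r \<ge> \<mu>"
    using u \<open>0 \<le> d\<close> by (simp add: r_def)
  have pu: "p * u = d / 2"
    using u by (simp add: p_def)
  have "(1 - p) * (r - \<mu>) = (2 * u - d) / (2 * u) * (u * d / (2 * u - d))"
    using u by (simp add: p_def r_def diff_divide_distrib)
  also have "\<dots> = d / 2"
    using u by (simp only: times_divide_times_eq) (simp add: divide_eq_eq)
  finally have pr: "(1 - p) * (r - \<mu>) = d / 2" .
  have LINT: "(LINT x|P. f x) = p * f (\<mu> - u) + (1 - p) * f r"
    if "f \<in> borel_measurable borel" for f :: "real \<Rightarrow> real"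
    using p that by (simp add: P_def g_def integral_distr)
  have P: "real_distribution P"
    by (simp add: P_def real_distribution_def real_distribution_axioms_def
        prob_space.prob_space_distr measure_pmf.prob_space_axioms)
  then interpret real_distribution P .
  have "integrable P (\<lambda>x. x)"
    unfolding P_def by (subst integrable_distr_eq) (auto intro!: integrable_measure_pmf_finite)
  moreover have "(LINT x|P. x) = \<mu>"
    using pu pr by (simp add: LINT algebra_simps)
  moreover have "(LINT x|P. \<bar>x - \<mu>\<bar>) = d"
    using pu pr r u by (simp add: LINT)
  ultimately show "P \<in> mean_mad_distributions \<mu> d"
    using P by (simp add: mean_mad_distributions_def)
  have cut: "\<mu> - u < t" "t \<le> r"
    using assms r by auto
  have "measure P {t..} = (LINT x|P. indicator {t..} x)"
    by simp
  also have "\<dots> = 1 - p"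
    using cut by (subst LINT) auto
  finally have mass: "measure P {t..} = 1 - p" .
  have "(LINT x|P. indicator {t..} x * x) = (1 - p) * r"
    using cut by (subst LINT) auto
  then show "cond_expectation_event P (\<lambda>x. x) {t..} = \<mu> + u * d / (2 * u - d)"
    using p mass
    by (subst cond_expectation_event_eq) (auto simp: r_def intro: finite_measure_axioms)
qed

theorem theorem3p2:
  fixes \<mu> d t :: real
  assumes "0 \<le> d" and "d < 2 * \<mu>" and "t < \<mu> - d / 2"
  shows "(SUP P \<in> mean_mad_distributions \<mu> d.
            ereal (cond_expectation_event P (\<lambda>x. x) {t..}))
         = ereal (\<mu> + (\<mu> - t) * d / (2 * (\<mu> - t) - d))"
    (is "?S = _")
proof (rule antisym)
  show "?S \<le> ereal (\<mu> + (\<mu> - t) * d / (2 * (\<mu> - t) - d))"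
    using cond_expectation_le[OF _ assms(1,3)] by (intro SUP_least) simp
next
  let ?v = "\<lambda>u. ereal (\<mu> + u * d / (2 * u - d))"
  have "?v u \<le> ?S" if "u > \<mu> - t" for u
    using two_point_law_attains[OF assms(1,3) that] by (metis (no_types, lifting) SUP_upper)
  then have "\<forall>\<^sub>F u in at_right (\<mu> - t). ?v u \<le> ?S"
    by (auto simp: eventually_at_filter)
  moreover have "(?v \<longlongrightarrow> ?v (\<mu> - t)) (at_right (\<mu> - t))"
    using assms by (intro tendsto_intros) auto
  ultimately show "?v (\<mu> - t) \<le> ?S"
    by (intro tendsto_upperbound[where F = "at_right (\<mu> - t)"]) auto
qed

end
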